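(* Let $R$ be a supertropical domain, let $n\ge1$, and let $A\in M_n(R)$ be a matrix whose tropical determinant $|A|$ is invertible in $R$. Put $I_A=A\,\dfrac{\operatorname{adj}(A)}{|A|}$. Then $|I_A|=\mathbb 1$.
   Context: A supertropical semiring $(R,\mathcal G_0,\nu)$ is a commutative semiring $R$ with unit $\mathbb 1$ and zero $\mathbb 0$ (with $\mathbb 0 r=\mathbb 0$ for all $r$), a semiring ideal $\mathcal G_0=\mathcal G\cup\{\mathbb 0\}$ (the ghost ideal, where $\mathcal G=\mathcal G_0\setminus\{\mathbb 0\}$), and an idempotent map $\nu:R\to\mathcal G_0$, written $a^\nu=\nu(a)$, preserving addition and multiplication, given by $\nu(a)=a+a$ and equal to the identity on $\mathcal G_0$, such that $a+b=a^\nu$ if $a^\nu=b^\nu$, and $a+b\in\{a,b\}$ if $a^\nu\ne b^\nu$. $\mathcal G_0$ is totally ordered by $a^\nu\le b^\nu$ iff $a^\nu+b^\nu=b^\nu$. Tangible elements: $\mathcal T=R\setminus\mathcal G_0$. It is a supertropical domain if $\mathcal T$ is a multiplicative monoid (closed under multiplication, containing $\mathbb 1$) and $\nu|_{\mathcal T}:\mathcal T\to\mathcal G$ is onto. Tropical determinant: $|A|=\sum_{\pi\in S_n}a_{1,\pi(1)}\cdots a_{n,\pi(n)}$ (the empty determinant is $\mathbb 1$). $\operatorname{adj}(A)$ is the transpose of $(a'_{i,j})$, where $a'_{i,j}$ is the tropical determinant of the matrix obtained from $A$ by deleting row $i$ and column $j$ (no signs). *)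

theory Defs
  imports "Jordan_Normal_Form.Determinant"
begin

text \<open>
  The underlying semiring \<open>R\<close> is the whole type \<open>'a\<close>. The class \<open>comm_semiring_1\<close> includes
  \<open>0 \<noteq> 1\<close>; this is no restriction for supertropical domains, where \<open>1\<close> is tangible and \<open>0\<close> is not.
\<close>

locale supertropical_semiring =
  fixes G0 :: "'a::comm_semiring_1 set"
    and nu :: "'a \<Rightarrow> 'a"
  assumes zero_ghost: "0 \<in> G0"
    and ghost_add: "\<lbrakk>a \<in> G0; b \<in> G0\<rbrakk> \<Longrightarrow> a + b \<in> G0"
    and ghost_mult: "a \<in> G0 \<Longrightarrow> r * a \<in> G0"
    and nu_ghost: "nu a \<in> G0"
    and nu_idem: "nu (nu a) = nu a"
    and nu_add: "nu (a + b) = nu a + nu b"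
    and nu_mult: "nu (a * b) = nu a * nu b"
    and nu_eq: "nu a = a + a"
    and nu_id: "a \<in> G0 \<Longrightarrow> nu a = a"
    and add_nu_eq: "nu a = nu b \<Longrightarrow> a + b = nu a"
    and add_nu_neq: "nu a \<noteq> nu b \<Longrightarrow> a + b \<in> {a, b}"
begin

text \<open>That \<open>G0\<close> is totally ordered by \<open>a \<le> b \<longleftrightarrow> a + b = b\<close> need not be assumed: it follows from
  the axioms above.\<close>

definition ghost_order :: "'a rel"
  where "ghost_order = {(a, b). a \<in> G0 \<and> b \<in> G0 \<and> a + b = b}"

lemma linear_order_ghost: "linear_order_on G0 ghost_order"
proof -
  have "a + a = a" if "a \<in> G0" for a
    using nu_eq[of a] nu_id[OF that] by simp
  then have "refl_on G0 ghost_order"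
    by (auto simp: refl_on_def ghost_order_def)
  moreover have "trans ghost_order"
    unfolding trans_def ghost_order_def by (auto, metis add.assoc)
  moreover have "antisym ghost_order"
    unfolding antisym_def ghost_order_def by (auto simp: add.commute)
  moreover have "total_on G0 ghost_order"
    unfolding total_on_def ghost_order_def
    using add_nu_neq nu_id by (auto, metis add.commute insertE singletonD)
  moreover have "ghost_order \<subseteq> G0 \<times> G0"
    by (auto simp: ghost_order_def)
  ultimately show ?thesis
    by (auto simp: linear_order_on_def partial_order_on_def preorder_on_def)
qed

definition ghosts :: "'a set"
  where "ghosts = G0 - {0}"

definition tangibles :: "'a set"
  where "tangibles = UNIV - G0"

end

text \<open>The axiom \<open>nu_onto\<close> says both that \<open>nu\<close> sends tangible elements to nonzero ghosts and that
  the resulting map is onto.\<close>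

locale supertropical_domain = supertropical_semiring +
  assumes one_tangible: "1 \<in> tangibles"
    and mult_tangible: "\<lbrakk>a \<in> tangibles; b \<in> tangibles\<rbrakk> \<Longrightarrow> a * b \<in> tangibles"
    and nu_onto: "nu ` tangibles = ghosts"

definition trop_det :: "'a::comm_semiring_1 mat \<Rightarrow> 'a"
  where "trop_det A =
    (\<Sum>p \<in> {p. p permutes {0..<dim_row A}}. \<Prod>i = 0..<dim_row A. A $$ (i, p i))"

lemma trop_det_empty: "dim_row A = 0 \<Longrightarrow> trop_det A = 1"
  by (simp add: trop_det_def)

definition trop_adj :: "'a::comm_semiring_1 mat \<Rightarrow> 'a mat"
  where "trop_adj A =
    transpose_mat (mat (dim_row A) (dim_col A) (\<lambda>(i, j). trop_det (mat_delete A i j)))"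

text \<open>The inverse of an invertible element; unspecified (via \<open>THE\<close>) on non-invertible ones.
  In a semiring, invertibility of \<open>a\<close> is \<open>a dvd 1\<close>.\<close>

definition unit_inv :: "'a::comm_semiring_1 \<Rightarrow> 'a"
  where "unit_inv a = (THE b. a * b = 1)"

lemma mult_unit_inv:
  assumes "a dvd 1"
  shows "a * unit_inv a = 1"
proof -
  from assms obtain b where b: "a * b = 1"
    by (metis dvdE)
  have "c = b" if "a * c = 1" for c
    using that b by (metis mult.assoc mult.commute mult_1_right)
  with b show ?thesis
    unfolding unit_inv_def by (rule theI)
qed

definition quasi_id :: "'a::comm_semiring_1 mat \<Rightarrow> 'a mat"
  where "quasi_id A = A * (unit_inv (trop_det A) \<cdot>\<^sub>m trop_adj A)"

end

theory Submission
  imports Defs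
begin

text \<open>
  Since \<open>|A|\<close> is a unit, it is tangible, so in the sum defining it one permutation \<open>\<sigma>\<close> strictly
  dominates: \<open>|A|\<close> equals the product of the entries \<open>a\<^bsub>r,\<sigma>(r)\<^esub>\<close> and absorbs the product of every other
  permutation (\<open>tangible_sum_dominant\<close>). The entries \<open>a\<^bsub>r,\<sigma>(r)\<^esub>\<close> divide a unit, hence are units, and
  \<open>w i j = a\<^bsub>i,\<sigma>(j)\<^esub> / a\<^bsub>j,\<sigma>(j)\<^esub>\<close> is a normalised matrix: its diagonal is \<open>1\<close>, and the product along
  every permutation other than the identity is absorbed by \<open>1\<close>. In the language of weighted digraphs,
  every nontrivial cycle has weight strictly below \<open>1\<close>.

  By Laplace expansion, the entry \<open>(i, j)\<close> of \<open>I\<^sub>A\<close> is the determinant of \<open>w\<close> with row \<open>j\<close> replaced by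
  row \<open>i\<close> (\<open>exists_normalisation\<close>). Diagonal entries are therefore \<open>1\<close>, and the identity contributes
  \<open>1\<close> to \<open>|I\<^sub>A|\<close>. It remains to see that every other permutation \<open>\<pi>\<close> contributes something absorbed
  by \<open>1\<close>. Multiplied out, its contribution is a sum of products of weights \<open>w s t\<close>, each over a family
  of \<open>n\<^sup>2\<close> edges \<open>s \<rightarrow> t\<close>: for each \<open>i\<close> a permutation whose edge at \<open>\<pi>(i)\<close> is made to start at \<open>i\<close>
  instead. Because \<open>\<pi>\<close> is a bijection, the starting points lost and gained cancel out over all \<open>i\<close>,
  so every vertex is the source of as many edges as it is the target of
  (\<open>balanced_replaced_rows\<close>). A balanced family decomposes into cycles, and it contains an edge that is
  not a loop when \<open>\<pi>\<close> is not the identity; hence its weight is absorbed by \<open>1\<close>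
  (\<open>absorbed_prod_balanced\<close>).

  The relation \<open>1 + x = 1\<close> takes the place of the strict inequality \<open>x\<^sup>\<nu> < 1\<^sup>\<nu>\<close>. It is closed under
  products and finite sums in every commutative semiring, so the supertropical axioms enter only
  through the existence of \<open>\<sigma>\<close>.
\<close>

section \<open>Elements absorbed by one\<close>

definition absorbed :: "'a::comm_semiring_1 \<Rightarrow> bool"
  where "absorbed x \<longleftrightarrow> 1 + x = 1"

lemma absorbed_mult:
  assumes "absorbed x" and "absorbed y"
  shows "absorbed (x * y)"
proof -
  have "1 = (1 + x) * (1 + y)"
    using assms by (simp add: absorbed_def)
  also have "\<dots> = (1 + x) + y + x * y"
    by (simp add: algebra_simps)
  also have "\<dots> = 1 + x * y"
    using assms by (simp add: absorbed_def)
  finally show ?thesis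
    by (simp add: absorbed_def)
qed

lemma absorbed_sum:
  assumes "finite I" and "\<And>i. i \<in> I \<Longrightarrow> absorbed (f i)"
  shows "absorbed (sum f I)"
  using assms
  by (induction I rule: finite_induct) (simp_all add: absorbed_def add.assoc[symmetric])

section \<open>Tangible sums\<close>

context supertropical_semiring
begin

text \<open>
  If \<open>x\<close> and \<open>y\<close> have the same \<open>\<nu>\<close>-value, then \<open>x = \<nu> x + z\<close>, and such a sum is a ghost unless it
  equals \<open>z\<close> and \<open>\<nu> z \<noteq> \<nu> x\<close>; neither is possible for a tangible \<open>x\<close>. Otherwise \<open>x + y\<close> is \<open>x\<close> or \<open>y\<close>,
  and \<open>x + y = y\<close> would give \<open>x = y + z\<close>, hence \<open>x = x + x\<close>, a ghost again.
\<close>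

lemma tangible_absorbs_summand:
  assumes "x \<in> tangibles" and "x + (y + z) = x"
  shows "x + y = x"
proof (cases "nu x = nu y")
  case True
  then have x: "x = nu x + z"
    using assms(2) add_nu_eq by (metis add.assoc)
  have False
  proof (cases "nu x = nu z")
    case True
    then have "x = nu (nu x)"
      using x add_nu_eq[of "nu x" z] nu_idem by simp
    then show False
      using assms(1) nu_ghost[of "nu x"] by (simp add: tangibles_def)
  next
    case False
    then have "x \<in> {nu x, z}"
      using x add_nu_neq[of "nu x" z] nu_idem by simp
    then show False
      using False assms(1) nu_ghost[of x] by (auto simp: tangibles_def)
  qed
  then show ?thesis ..
next
  case False
  then consider "x + y = x" | "x + y = y"
    using add_nu_neq by blast
  then show ?thesis
  proof cases
    case 2
    then have "x = y + z"
      using assms(2) by (metis add.assoc)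
    then have "x = nu x"
      using assms(2) nu_eq by simp
    then show ?thesis
      using assms(1) nu_ghost[of x] by (simp add: tangibles_def)
  qed
qed

text \<open>
  Two summands of equal \<open>\<nu>\<close>-value add up to a ghost, so a tangible sum cannot arise from a tie:
  it is the value of a single summand, and that summand absorbs each of the others.
\<close>

lemma tangible_sum_dominant:
  assumes "finite I" and "sum f I \<in> tangibles"
  shows "\<exists>i\<in>I. f i = sum f I \<and> (\<forall>j\<in>I - {i}. sum f I + f j = sum f I)"
  using assms
proof (induction I rule: finite_induct)
  case empty
  then show ?case
    using zero_ghost by (simp add: tangibles_def)
next
  case (insert x I)
  have sum: "sum f (insert x I) = f x + sum f I"
    using insert.hyps by simp
  have "nu (f x) \<noteq> nu (sum f I)"
    using insert.prems add_nu_eq[of "f x" "sum f I"] nu_ghost[of "f x"]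
    unfolding sum tangibles_def by auto
  then consider "f x + sum f I = sum f I" | "f x + sum f I = f x"
    using add_nu_neq by blast
  then show ?case
  proof cases
    case 1
    then obtain i where "i \<in> I" "f i = sum f I" "\<forall>j\<in>I - {i}. sum f I + f j = sum f I"
      using insert.IH insert.prems sum by auto
    then show ?thesis
      using 1 insert.hyps unfolding sum by (intro bexI[of _ i]) (auto simp: add.commute)
  next
    case 2
    have "f x + f j = f x" if "j \<in> I" for j
    proof (rule tangible_absorbs_summand)
      show "f x \<in> tangibles"
        using insert.prems sum 2 by simp
      show "f x + (f j + sum f (I - {j})) = f x"
        using 2 sum.remove[OF insert.hyps(1) that, of f] by simp
    qed
    then show ?thesis
      using 2 insert.hyps unfolding sum by (intro bexI[of _ x]) auto
  qed
qed

end

lemma (in supertropical_domain) unit_tangible: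
  assumes "x dvd 1"
  shows "x \<in> tangibles"
proof -
  obtain y where "1 = x * y"
    using assms by (elim dvdE)
  then show ?thesis
    using ghost_mult[of x y] one_tangible by (auto simp: tangibles_def mult.commute)
qed

section \<open>Balanced families of edges\<close>

text \<open>
  A minimal nonempty subset mapped into itself is mapped onto itself, since its image is also mapped
  into itself. This is how cycles are found below: following outgoing edges gives a self-map of the
  finite vertex set, and on \<open>T\<close> this map is a permutation.
\<close>

lemma exists_bij_invariant_subset:
  assumes "finite S" and "S \<noteq> {}" and "f ` S \<subseteq> S"
  shows "\<exists>T\<subseteq>S. T \<noteq> {} \<and> bij_betw f T T"
  using assms
proof (induction S rule: finite_psubset_induct)
  case (psubset S)
  show ?case
  proof (cases "f ` S = S")
    case True
    then show ?thesis
      using psubset.hyps psubset.prems by (metis bij_betw_def eq_card_imp_inj_on order_refl)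
  next
    case False
    then have "f ` S \<subset> S" "f ` S \<noteq> {}" "f ` (f ` S) \<subseteq> f ` S"
      using psubset.prems by auto
    from psubset.IH[OF this] show ?thesis
      using psubset.prems by (meson order_trans)
  qed
qed

text \<open>
  Each vertex is the source of as many edges as it is the target of; summing an arbitrary function
  over both ends is an equivalent form that needs no counting and behaves well under set difference
  and reindexing. The function is integer-valued so that subtraction is exact.
\<close>

definition balanced :: "'e set \<Rightarrow> ('e \<Rightarrow> 'v) \<Rightarrow> ('e \<Rightarrow> 'v) \<Rightarrow> bool"
  where "balanced E src tgt \<longleftrightarrow> (\<forall>h::'v \<Rightarrow> int. (\<Sum>e\<in>E. h (src e)) = (\<Sum>e\<in>E. h (tgt e)))"

lemma balanced_Diff:
  assumes "finite E" and "C \<subseteq> E" and "balanced E src tgt" and "balanced C src tgt"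
  shows "balanced (E - C) src tgt"
  using assms by (simp add: balanced_def sum_diff)

text \<open>
  A balanced family without loops has an outgoing edge at each vertex that an edge reaches. Choosing
  one outgoing edge per vertex and restricting to a set that the choice permutes yields a subfamily
  \<open>C\<close> forming one or more disjoint cycles. Extended by fixed points, these cycles are a permutation
  other than the identity, so \<open>C\<close> has absorbed weight; what remains is again balanced and smaller.
\<close>

lemma absorbed_prod_balanced_loopfree:
  fixes w :: "'v \<Rightarrow> 'v \<Rightarrow> 'a::comm_semiring_1"
  assumes "finite V" and loop: "\<And>v. v \<in> V \<Longrightarrow> w v v = 1"
    and perm: "\<And>\<rho>. \<lbrakk>\<rho> permutes V; \<rho> \<noteq> id\<rbrakk> \<Longrightarrow> absorbed (\<Prod>v\<in>V. w v (\<rho> v))"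
    and "finite E" and "E \<noteq> {}" and "balanced E src tgt"
    and "src ` E \<subseteq> V" and "\<And>e. e \<in> E \<Longrightarrow> src e \<noteq> tgt e"
  shows "absorbed (\<Prod>e\<in>E. w (src e) (tgt e))"
  using assms(4-)
proof (induction E rule: finite_psubset_induct)
  case (psubset E)
  define S where "S = src ` E"
  have tgt_S: "tgt e \<in> S" if "e \<in> E" for e
  proof (rule ccontr)
    assume "tgt e \<notin> S"
    \<comment> \<open>The indicator of a vertex that is a target but not a source violates balance.\<close>
    let ?h = "\<lambda>v. if v = tgt e then 1 else (0::int)"
    have "(\<Sum>e\<in>E. ?h (src e)) = 0"
      using \<open>tgt e \<notin> S\<close> by (intro sum.neutral) (force simp: S_def)
    moreover have "(\<Sum>e\<in>E. ?h (tgt e)) \<ge> ?h (tgt e)"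
      using psubset.hyps that by (intro member_le_sum) auto
    ultimately show False
      using psubset.prems(2)[unfolded balanced_def, rule_format, of ?h] by simp
  qed
  define edge where "edge v = (SOME e. e \<in> E \<and> src e = v)" for v
  have edge: "edge v \<in> E" "src (edge v) = v" if "v \<in> S" for v
    using that someI_ex[of "\<lambda>e. e \<in> E \<and> src e = v"] unfolding S_def edge_def by auto
  define f where "f v = tgt (edge v)" for v
  have "finite S" "S \<noteq> {}" "f ` S \<subseteq> S"
    using psubset.hyps psubset.prems(1) edge(1) tgt_S by (auto simp: S_def f_def)
  from exists_bij_invariant_subset[OF this] obtain T
    where T: "T \<subseteq> S" "T \<noteq> {}" and f: "bij_betw f T T"
    by blast
  have "finite T"
    using T(1) \<open>finite S\<close> finite_subset by blast
  have TV: "T \<subseteq> V"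
    using T(1) psubset.prems(3) by (auto simp: S_def)
  define C where "C = edge ` T"
  have C: "C \<subseteq> E"
    using T(1) edge(1) by (auto simp: C_def)
  have inj: "inj_on edge T"
    using T(1) edge(2) by (metis inj_onI subsetD)
  have src_edge: "src (edge v) = v" if "v \<in> T" for v
    using that T(1) edge(2) by blast
  have C_balanced: "balanced C src tgt"
    unfolding balanced_def
  proof
    fix h :: "'v \<Rightarrow> int"
    have "(\<Sum>e\<in>C. h (src e)) = (\<Sum>v\<in>T. h v)"
      unfolding C_def using inj src_edge by (simp add: sum.reindex)
    also have "\<dots> = (\<Sum>v\<in>T. h (f v))"
      using sum.reindex_bij_betw[OF f, of h] by simp
    also have "\<dots> = (\<Sum>e\<in>C. h (tgt e))"
      unfolding C_def f_def using inj by (simp add: sum.reindex)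
    finally show "(\<Sum>e\<in>C. h (src e)) = (\<Sum>e\<in>C. h (tgt e))" .
  qed
  define \<rho> where "\<rho> v = (if v \<in> T then f v else v)" for v
  have "bij_betw \<rho> T T"
    using f by (simp add: \<rho>_def cong: bij_betw_cong)
  then have "\<rho> permutes T"
    by (rule bij_imp_permutes) (simp add: \<rho>_def)
  then have "\<rho> permutes V"
    using TV by (rule permutes_subset)
  moreover have "\<rho> \<noteq> id"
  proof -
    obtain v where "v \<in> T"
      using T(2) by blast
    then have "f v \<noteq> v"
      using psubset.prems(4)[of "edge v"] src_edge[of v] C by (auto simp: C_def f_def)
    with \<open>v \<in> T\<close> show ?thesis
      by (auto simp: \<rho>_def fun_eq_iff)
  qed
  ultimately have "absorbed (\<Prod>v\<in>V. w v (\<rho> v))"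
    by (rule perm)
  also have "(\<Prod>v\<in>V. w v (\<rho> v)) = (\<Prod>v\<in>T. w v (\<rho> v))"
    using \<open>finite V\<close> TV loop by (intro prod.mono_neutral_right) (auto simp: \<rho>_def)
  also have "\<dots> = (\<Prod>e\<in>C. w (src e) (tgt e))"
    unfolding C_def using inj src_edge by (simp add: prod.reindex \<rho>_def f_def)
  finally have absorbed_C: "absorbed (\<Prod>e\<in>C. w (src e) (tgt e))" .
  have split: "(\<Prod>e\<in>E. w (src e) (tgt e))
      = (\<Prod>e\<in>E - C. w (src e) (tgt e)) * (\<Prod>e\<in>C. w (src e) (tgt e))"
    using C psubset.hyps by (rule prod.subset_diff)
  show ?case
  proof (cases "E - C = {}")
    case True
    then have "(\<Prod>e\<in>E - C. w (src e) (tgt e)) = 1"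
      by (simp only: prod.empty)
    then show ?thesis
      using split absorbed_C by simp
  next
    case False
    have "E - C \<subset> E"
      using C T(2) by (auto simp: C_def)
    then have "absorbed (\<Prod>e\<in>E - C. w (src e) (tgt e))"
      using False balanced_Diff[OF psubset.hyps C psubset.prems(2) C_balanced] psubset.prems(3,4)
      by (intro psubset.IH) auto
    then show ?thesis
      using split absorbed_C absorbed_mult by metis
  qed
qed

text \<open>
  Loops have weight \<open>1\<close> and are balanced by themselves, so they can be discarded.
\<close>

lemma absorbed_prod_balanced:
  fixes w :: "'v \<Rightarrow> 'v \<Rightarrow> 'a::comm_semiring_1"
  assumes "finite V" and loop: "\<And>v. v \<in> V \<Longrightarrow> w v v = 1"
    and perm: "\<And>\<rho>. \<lbrakk>\<rho> permutes V; \<rho> \<noteq> id\<rbrakk> \<Longrightarrow> absorbed (\<Prod>v\<in>V. w v (\<rho> v))"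
    and "finite E" and bal: "balanced E src tgt"
    and src: "src ` E \<subseteq> V" and nonloop: "\<exists>e\<in>E. src e \<noteq> tgt e"
  shows "absorbed (\<Prod>e\<in>E. w (src e) (tgt e))"
proof -
  define L where "L = {e \<in> E. src e = tgt e}"
  have "balanced L src tgt"
    by (auto simp: balanced_def L_def intro!: sum.cong)
  then have "balanced (E - L) src tgt"
    using \<open>finite E\<close> bal by (intro balanced_Diff) (auto simp: L_def)
  moreover have "finite (E - L)" "E - L \<noteq> {}" "src ` (E - L) \<subseteq> V"
    using \<open>finite E\<close> nonloop src by (auto simp: L_def)
  moreover have "src e \<noteq> tgt e" if "e \<in> E - L" for e
    using that by (simp add: L_def)
  ultimately have "absorbed (\<Prod>e\<in>E - L. w (src e) (tgt e))"
    using absorbed_prod_balanced_loopfree[where w = w, OF \<open>finite V\<close> loop perm] by metis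
  also have "(\<Prod>e\<in>E - L. w (src e) (tgt e)) = (\<Prod>e\<in>E. w (src e) (tgt e))"
  proof (rule prod.mono_neutral_left)
    show "\<forall>e\<in>E - (E - L). w (src e) (tgt e) = 1"
    proof
      fix e assume "e \<in> E - (E - L)"
      then have "tgt e = src e" "src e \<in> V"
        using src by (auto simp: L_def)
      then show "w (src e) (tgt e) = 1"
        using loop by simp
    qed
  qed (use \<open>finite E\<close> in auto)
  finally show ?thesis .
qed

section \<open>Laplace expansion\<close>

text \<open>
  Permutations of the remaining rows and columns correspond, through \<open>permutation_insert\<close>, to the
  permutations of all rows that send the deleted row to the deleted column. This keeps the original
  indices of \<open>A\<close>, so that minors for different columns can be compared.
\<close>

lemma trop_det_mat_delete:
  fixes A :: "'a::comm_semiring_1 mat"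
  assumes A: "A \<in> carrier_mat n n" and i: "i < n" and j: "j < n"
  shows "trop_det (mat_delete A i j)
    = (\<Sum>p | p permutes {0..<n} \<and> p i = j. \<Prod>r\<in>{0..<n} - {i}. A $$ (r, p r))"
proof -
  obtain l where n: "n = Suc l"
    using i by (cases n) auto
  have A': "A \<in> carrier_mat (Suc l) (Suc l)" and i': "i < Suc l" and j': "j < Suc l"
    using A i j n by auto
  have dim: "dim_row (mat_delete A i j) = l"
    using A' by simp
  have "(\<Sum>p | p permutes {0..<n} \<and> p i = j. \<Prod>r\<in>{0..<n} - {i}. A $$ (r, p r))
      = (\<Sum>p\<in>permutation_insert i j ` {q. q permutes {0..<l}}. \<Prod>r\<in>{0..<n} - {i}. A $$ (r, p r))"
    using permutation_fix[OF i' j'] n by simp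
  also have "\<dots> = (\<Sum>q | q permutes {0..<l}.
      \<Prod>r\<in>{0..<n} - {i}. A $$ (r, permutation_insert i j q r))"
    using sum.reindex[OF permutation_insert_inj_on[OF i' j']] by (simp add: o_def)
  also have "\<dots> = (\<Sum>q | q permutes {0..<l}. \<Prod>r\<in>{0..<l}. mat_delete A i j $$ (r, q r))"
  proof (rule sum.cong[OF refl])
    fix q assume "q \<in> {q. q permutes {0..<l}}"
    then have q: "q permutes {0..<l}" by simp
    have "(\<Prod>r\<in>{0..<n} - {i}. A $$ (r, permutation_insert i j q r))
        = (\<Prod>r\<in>insert_index i ` {0..<l}. A $$ (r, permutation_insert i j q r))"
      using insert_index_image[OF i'] n by simp
    also have "\<dots> = (\<Prod>r\<in>{0..<l}. A $$ (insert_index i r, permutation_insert i j q (insert_index i r)))"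
      using prod.reindex[OF insert_index_inj_on] by (simp add: o_def)
    also have "\<dots> = (\<Prod>r\<in>{0..<l}. mat_delete A i j $$ (r, q r))"
    proof (rule prod.cong[OF refl])
      fix r assume r: "r \<in> {0..<l}"
      have "permutation_insert i j q (insert_index i r) = insert_index j (q r)"
        by (simp add: permutation_insert_expand insert_index_def)
      moreover have "q r < l"
        using r permutes_in_image[OF q, of r] by simp
      ultimately show "A $$ (insert_index i r, permutation_insert i j q (insert_index i r))
          = mat_delete A i j $$ (r, q r)"
        using mat_delete_index[OF A' i' j', of r "q r"] r by simp
    qed
    finally show "(\<Prod>r\<in>{0..<n} - {i}. A $$ (r, permutation_insert i j q r))
        = (\<Prod>r\<in>{0..<l}. mat_delete A i j $$ (r, q r))" .
  qed
  also have "\<dots> = trop_det (mat_delete A i j)"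
    unfolding trop_det_def dim by simp
  finally show ?thesis by simp
qed

text \<open>
  The right-hand side is the determinant of \<open>A\<close> with row \<open>j\<close> replaced by row \<open>i\<close>; sorting its
  permutations by the image of \<open>j\<close> is the Laplace expansion along that row.
\<close>

lemma mult_trop_adj_index:
  fixes A :: "'a::comm_semiring_1 mat"
  assumes A: "A \<in> carrier_mat n n" and i: "i < n" and j: "j < n"
  shows "(\<Sum>k<n. A $$ (i, k) * trop_det (mat_delete A j k))
    = (\<Sum>p | p permutes {0..<n}. \<Prod>r<n. A $$ ((if r = j then i else r), p r))"
proof -
  let ?P = "{p. p permutes {0..<n}}"
  let ?term = "\<lambda>p. \<Prod>r<n. A $$ ((if r = j then i else r), p r)"
  have "A $$ (i, k) * trop_det (mat_delete A j k) = sum ?term {p \<in> ?P. p j = k}"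
    if "k \<in> {..<n}" for k
  proof -
    have "A $$ (i, k) * (\<Prod>r\<in>{0..<n} - {j}. A $$ (r, p r)) = ?term p" if "p j = k" for p
    proof -
      have "?term p = A $$ (i, p j) * (\<Prod>r\<in>{..<n} - {j}. A $$ ((if r = j then i else r), p r))"
        using j by (subst prod.remove[of _ j]) auto
      also have "(\<Prod>r\<in>{..<n} - {j}. A $$ ((if r = j then i else r), p r)) = (\<Prod>r\<in>{0..<n} - {j}. A $$ (r, p r))"
        by (intro prod.cong) auto
      finally show ?thesis
        using that by simp
    qed
    then show ?thesis
      using that trop_det_mat_delete[OF A j, of k] by (simp add: sum_distrib_left)
  qed
  then have "(\<Sum>k<n. A $$ (i, k) * trop_det (mat_delete A j k))
      = (\<Sum>k<n. sum ?term {p \<in> ?P. p j = k})"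
    by (rule sum.cong[OF refl])
  also have "\<dots> = sum ?term ?P"
    using j by (intro sum.group) (auto simp: finite_permutations permutes_in_image)
  finally show ?thesis .
qed

lemma quasi_id_index:
  fixes A :: "'a::comm_semiring_1 mat"
  assumes A: "A \<in> carrier_mat n n" and i: "i < n" and j: "j < n"
  shows "quasi_id A $$ (i, j)
    = unit_inv (trop_det A) * (\<Sum>p | p permutes {0..<n}. \<Prod>r<n. A $$ ((if r = j then i else r), p r))"
proof -
  have "quasi_id A $$ (i, j)
      = (\<Sum>k<n. A $$ (i, k) * (unit_inv (trop_det A) * trop_det (mat_delete A j k)))"
    using A i j
    by (simp add: quasi_id_def trop_adj_def scalar_prod_def atLeast0LessThan)
  also have "\<dots> = unit_inv (trop_det A) * (\<Sum>k<n. A $$ (i, k) * trop_det (mat_delete A j k))"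
    by (simp add: sum_distrib_left mult_ac)
  finally show ?thesis
    using mult_trop_adj_index[OF A i j] by simp
qed

section \<open>The quasi-identity\<close>

text \<open>
  For each \<open>i\<close>, the sources are all the vertices except that \<open>\<pi> i\<close> is lost and \<open>i\<close> is repeated.
  Over all \<open>i\<close>, each vertex is lost once and repeated once, so in total every vertex is a source, just
  as it is a target, exactly \<open>n\<close> times.
\<close>

lemma balanced_replaced_rows:
  fixes \<pi> :: "nat \<Rightarrow> nat"
  assumes \<pi>: "\<pi> permutes {..<n}" and \<rho>: "\<And>i. i < n \<Longrightarrow> \<rho> i permutes {..<n}"
  shows "balanced ({..<n} \<times> {..<n}) (\<lambda>(i, r). (if r = \<pi> i then i else r)) (\<lambda>(i, r). \<rho> i r)"
  unfolding balanced_def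
proof
  fix h :: "nat \<Rightarrow> int"
  have row: "(\<Sum>r<n. h (if r = \<pi> i then i else r)) = (\<Sum>r<n. h r) - h (\<pi> i) + h i" if "i < n" for i
  proof -
    have "\<pi> i \<in> {..<n}"
      using that permutes_in_image[OF \<pi>, of i] by simp
    then have "(\<Sum>r<n. h (if r = \<pi> i then i else r)) = h i + (\<Sum>r\<in>{..<n} - {\<pi> i}. h (if r = \<pi> i then i else r))"
      by (subst sum.remove[of _ "\<pi> i"]) auto
    also have "(\<Sum>r\<in>{..<n} - {\<pi> i}. h (if r = \<pi> i then i else r)) = (\<Sum>r<n. h r) - h (\<pi> i)"
      using \<open>\<pi> i \<in> {..<n}\<close> by (subst sum.remove[of "{..<n}" "\<pi> i"]) auto
    finally show ?thesis by simp
  qed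
  have "(\<Sum>e\<in>{..<n} \<times> {..<n}. h (case e of (i, r) \<Rightarrow> (if r = \<pi> i then i else r)))
      = (\<Sum>i<n. \<Sum>r<n. h (if r = \<pi> i then i else r))"
    by (simp add: sum.cartesian_product case_prod_beta)
  also have "\<dots> = (\<Sum>i<n. (\<Sum>r<n. h r) - h (\<pi> i) + h i)"
    using row by simp
  also have "\<dots> = (\<Sum>i<n. \<Sum>r<n. h r)"
    using sum.permute[OF \<pi>, of h] by (simp add: sum.distrib sum_subtractf o_def)
  also have "\<dots> = (\<Sum>i<n. \<Sum>r<n. h (\<rho> i r))"
    using sum.permute[OF \<rho>, of _ h] by (simp add: o_def)
  also have "\<dots> = (\<Sum>e\<in>{..<n} \<times> {..<n}. h (case e of (i, r) \<Rightarrow> \<rho> i r))"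
    by (simp add: sum.cartesian_product case_prod_beta)
  finally show "(\<Sum>e\<in>{..<n} \<times> {..<n}. h (case e of (i, r) \<Rightarrow> (if r = \<pi> i then i else r)))
      = (\<Sum>e\<in>{..<n} \<times> {..<n}. h (case e of (i, r) \<Rightarrow> \<rho> i r))" .
qed

text \<open>
  If all edges were loops, both \<open>i\<close> and \<open>j\<close> would be mapped to \<open>i\<close>.
\<close>

lemma replaced_row_nonloop:
  assumes "\<rho> permutes {..<n}" and "i < n" and "j < n" and "i \<noteq> j"
  shows "\<exists>r<n. (if r = j then i else r) \<noteq> \<rho> r"
proof (rule ccontr)
  assume "\<not> ?thesis"
  then have "\<rho> r = (if r = j then i else r)" if "r < n" for r
    using that by metis
  from this[of i] this[of j] have "\<rho> i = \<rho> j"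
    using assms by simp
  then show False
    using permutes_inj[OF assms(1)] assms(4) by (auto dest: injD)
qed

text \<open>
  The product over \<open>i\<close> is the contribution of \<open>\<pi>\<close> to the determinant of the quasi-identity. Each term
  of its expansion picks a permutation \<open>g i\<close> for every \<open>i\<close> and is the weight of a balanced family of
  \<open>n\<^sup>2\<close> edges; a row \<open>i\<close> moved by \<open>\<pi>\<close> supplies the edge that is not a loop.
\<close>

lemma absorbed_replaced_rows:
  fixes w :: "nat \<Rightarrow> nat \<Rightarrow> 'a::comm_semiring_1"
  assumes loop: "\<And>v. v < n \<Longrightarrow> w v v = 1"
    and perm: "\<And>\<rho>. \<lbrakk>\<rho> permutes {..<n}; \<rho> \<noteq> id\<rbrakk> \<Longrightarrow> absorbed (\<Prod>v<n. w v (\<rho> v))"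
    and \<pi>: "\<pi> permutes {..<n}" "\<pi> \<noteq> id"
  shows "absorbed (\<Prod>i<n. \<Sum>\<rho> | \<rho> permutes {..<n}. \<Prod>r<n. w (if r = \<pi> i then i else r) (\<rho> r))"
proof -
  let ?P = "{\<rho>. \<rho> permutes {..<n}}"
  let ?E = "{..<n} \<times> {..<n}"
  obtain i where i: "\<pi> i \<noteq> i" "i < n" "\<pi> i < n"
    using \<pi> by (metis eq_id_iff lessThan_iff permutes_in_image permutes_not_in)
  have "absorbed (\<Prod>i<n. \<Prod>r<n. w (if r = \<pi> i then i else r) (g i r))" if "g \<in> {..<n} \<rightarrow>\<^sub>E ?P" for g
  proof -
    have g: "g k permutes {..<n}" if "k < n" for k
      using that \<open>g \<in> _\<close> by auto
    let ?src = "\<lambda>(i, r). (if r = \<pi> i then i else r)"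
    let ?tgt = "\<lambda>(i, r). g i r"
    have "absorbed (\<Prod>e\<in>?E. w (?src e) (?tgt e))"
    proof (rule absorbed_prod_balanced[where V = "{..<n}"])
      show "balanced ?E ?src ?tgt"
        using \<pi>(1) g by (rule balanced_replaced_rows)
      show "?src ` ?E \<subseteq> {..<n}"
        by auto
      obtain r where "r < n" "(if r = \<pi> i then i else r) \<noteq> g i r"
        using replaced_row_nonloop[OF g[OF i(2)] i(2,3)] i(1) by metis
      then show "\<exists>e\<in>?E. ?src e \<noteq> ?tgt e"
        using i(2) by (intro bexI[of _ "(i, r)"]) auto
    qed (use loop perm in auto)
    then show ?thesis
      by (simp add: prod.cartesian_product case_prod_beta)
  qed
  moreover have "finite ?P"
    by (simp add: finite_permutations)
  ultimately have "absorbed (\<Sum>g\<in>{..<n} \<rightarrow>\<^sub>E ?P. \<Prod>i<n. \<Prod>r<n. w (if r = \<pi> i then i else r) (g i r))"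
    by (intro absorbed_sum finite_PiE finite_lessThan)
  then show ?thesis
    using \<open>finite ?P\<close> by (subst prod_sum_PiE) simp_all
qed

lemma unit_factor_of_prod:
  fixes f :: "'b \<Rightarrow> 'a::comm_semiring_1"
  assumes "finite I" and "prod f I dvd 1" and "i \<in> I"
  shows "f i dvd 1"
  using dvd_trans[OF dvd_prodI[OF assms(1,3), of f] assms(2)] .

text \<open>
  Permuting the columns of \<open>A\<close> by the dominant \<open>\<sigma>\<close> and dividing each by its diagonal entry gives \<open>w\<close>.
  The divisors multiply to \<open>|A|\<close> whatever the order of the columns, so passing from \<open>A\<close> to \<open>w\<close>
  divides every product over one entry per column by \<open>|A|\<close>, even if rows are repeated. For products
  with distinct rows this gives the condition on permutations, and for a replaced row it accounts for
  the division by \<open>|A|\<close> in the quasi-identity.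
\<close>

lemma exists_normalisation:
  fixes G0 :: "'a::comm_semiring_1 set" and nu :: "'a \<Rightarrow> 'a" and A :: "'a mat"
  assumes "supertropical_domain G0 nu" and A: "A \<in> carrier_mat n n" and unit: "trop_det A dvd 1"
  obtains w :: "nat \<Rightarrow> nat \<Rightarrow> 'a"
  where "\<And>v. v < n \<Longrightarrow> w v v = 1"
    and "\<And>\<rho>. \<lbrakk>\<rho> permutes {..<n}; \<rho> \<noteq> id\<rbrakk> \<Longrightarrow> absorbed (\<Prod>v<n. w v (\<rho> v))"
    and "\<And>i j. \<lbrakk>i < n; j < n\<rbrakk> \<Longrightarrow>
      quasi_id A $$ (i, j) = (\<Sum>\<rho> | \<rho> permutes {..<n}. \<Prod>r<n. w (if r = j then i else r) (\<rho> r))"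
proof -
  interpret supertropical_domain G0 nu by fact
  let ?P = "{p. p permutes {..<n}}"
  let ?term = "\<lambda>p. \<Prod>r<n. A $$ (r, p r)"
  define d where "d = trop_det A"
  have d: "d = sum ?term ?P"
    using A by (simp add: d_def trop_det_def atLeast0LessThan)
  have "finite ?P"
    by (simp add: finite_permutations)
  moreover have "sum ?term ?P \<in> tangibles"
    using unit_tangible[OF unit] d d_def by simp
  ultimately obtain \<sigma> where "\<sigma> \<in> ?P" and "?term \<sigma> = sum ?term ?P"
    and "\<forall>p\<in>?P - {\<sigma>}. sum ?term ?P + ?term p = sum ?term ?P"
    using tangible_sum_dominant[of ?P ?term] by blast
  then have \<sigma>: "\<sigma> permutes {..<n}" and dominant: "?term \<sigma> = d"
    and others: "\<And>p. \<lbrakk>p permutes {..<n}; p \<noteq> \<sigma>\<rbrakk> \<Longrightarrow> d + ?term p = d"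
    unfolding d by blast+
  define u where "u = unit_inv d"
  have u: "d * u = 1"
    unfolding u_def d_def by (rule mult_unit_inv) (rule unit)
  define v where "v j = unit_inv (A $$ (j, \<sigma> j))" for j
  have v: "A $$ (j, \<sigma> j) * v j = 1" if "j < n" for j
    unfolding v_def using that unit dominant
    by (intro mult_unit_inv unit_factor_of_prod[of "{..<n}" "\<lambda>r. A $$ (r, \<sigma> r)" j])
      (auto simp: d_def)
  define w where "w i j = A $$ (i, \<sigma> j) * v j" for i j
  have "d * prod v {..<n} = 1"
    using v unfolding dominant[symmetric] by (simp add: prod.distrib[symmetric])
  then have prod_v: "prod v {..<n} = u"
    using u by (metis mult.assoc mult.commute mult_1_right)
  have prod_w: "(\<Prod>r<n. w (s r) (\<rho> r)) = u * (\<Prod>r<n. A $$ (s r, (\<sigma> \<circ> \<rho>) r))"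
    if "\<rho> permutes {..<n}" for s \<rho>
    using prod.permute[OF that, of v] prod_v
    by (simp add: w_def prod.distrib o_def mult.commute)
  show thesis
  proof
    fix \<rho> assume \<rho>: "\<rho> permutes {..<n}" "\<rho> \<noteq> id"
    have "\<sigma> \<circ> \<rho> \<noteq> \<sigma>"
    proof
      assume "\<sigma> \<circ> \<rho> = \<sigma>"
      then have "\<rho> x = x" for x
        using permutes_inj[OF \<sigma>] by (metis comp_apply injD)
      then show False
        using \<rho>(2) by auto
    qed
    then have "d + ?term (\<sigma> \<circ> \<rho>) = d"
      using others permutes_compose[OF \<rho>(1) \<sigma>] by blast
    then have "u * d + u * ?term (\<sigma> \<circ> \<rho>) = u * d"
      by (metis distrib_left)
    then show "absorbed (\<Prod>v<n. w v (\<rho> v))"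
      using prod_w[OF \<rho>(1), of "\<lambda>r. r"] u by (simp add: absorbed_def mult.commute)
  next
    fix i j assume ij: "i < n" "j < n"
    have "quasi_id A $$ (i, j)
        = (\<Sum>p\<in>?P. u * (\<Prod>r<n. A $$ ((if r = j then i else r), p r)))"
      using quasi_id_index[OF A ij]
      by (simp add: u_def d_def atLeast0LessThan sum_distrib_left)
    also have "\<dots> = (\<Sum>\<rho>\<in>?P. u * (\<Prod>r<n. A $$ ((if r = j then i else r), (\<sigma> \<circ> \<rho>) r)))"
      by (rule setum_permutations_compose_left[OF \<sigma>])
    also have "\<dots> = (\<Sum>\<rho>\<in>?P. \<Prod>r<n. w (if r = j then i else r) (\<rho> r))"
      using prod_w by (intro sum.cong) auto
    finally show "quasi_id A $$ (i, j) = (\<Sum>\<rho>\<in>?P. \<Prod>r<n. w (if r = j then i else r) (\<rho> r))" .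
  qed (simp add: w_def v)
qed

lemma quasi_id_diag:
  fixes A :: "'a::comm_semiring_1 mat"
  assumes A: "A \<in> carrier_mat n n" and "trop_det A dvd 1" and "i < n"
  shows "quasi_id A $$ (i, i) = 1"
proof -
  have "quasi_id A $$ (i, i) = trop_det A * unit_inv (trop_det A)"
  proof -
    have "(if r = i then i else r) = r" for r :: nat
      by simp
    then show ?thesis
      using quasi_id_index[OF A \<open>i < n\<close> \<open>i < n\<close>] A
      by (simp only:) (simp add: trop_det_def atLeast0LessThan mult.commute)
  qed
  then show ?thesis
    using mult_unit_inv[OF assms(2)] by simp
qed

theorem corollary4p10:
  fixes G0 :: "'a::comm_semiring_1 set"
    and nu :: "'a \<Rightarrow> 'a"
    and n :: nat
    and A :: "'a mat"
  assumes "supertropical_domain G0 nu"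
    and "n \<ge> 1"
    and "A \<in> carrier_mat n n"
    and "trop_det A dvd 1"
  shows "trop_det (quasi_id A) = 1"
proof -
  let ?P = "{\<pi>. \<pi> permutes {..<n}}"
  let ?term = "\<lambda>\<pi>. \<Prod>i<n. quasi_id A $$ (i, \<pi> i)"
  obtain w :: "nat \<Rightarrow> nat \<Rightarrow> 'a"
    where w: "\<And>v. v < n \<Longrightarrow> w v v = 1"
      "\<And>\<rho>. \<lbrakk>\<rho> permutes {..<n}; \<rho> \<noteq> id\<rbrakk> \<Longrightarrow> absorbed (\<Prod>v<n. w v (\<rho> v))"
    and entry: "\<And>i j. \<lbrakk>i < n; j < n\<rbrakk> \<Longrightarrow>
      quasi_id A $$ (i, j) = (\<Sum>\<rho> | \<rho> permutes {..<n}. \<Prod>r<n. w (if r = j then i else r) (\<rho> r))"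
    by (rule exists_normalisation[OF assms(1,3,4)]) (rule that)
  have "absorbed (?term \<pi>)" if "\<pi> \<in> ?P - {id}" for \<pi>
  proof -
    have "\<pi> permutes {..<n}" "\<pi> \<noteq> id"
      using that by auto
    then have "absorbed (\<Prod>i<n. \<Sum>\<rho> | \<rho> permutes {..<n}. \<Prod>r<n. w (if r = \<pi> i then i else r) (\<rho> r))"
      using w by (intro absorbed_replaced_rows)
    also have "(\<Prod>i<n. \<Sum>\<rho> | \<rho> permutes {..<n}. \<Prod>r<n. w (if r = \<pi> i then i else r) (\<rho> r)) = ?term \<pi>"
    proof (rule prod.cong[OF refl])
      fix i assume "i \<in> {..<n}"
      then have "i < n" "\<pi> i < n"
        using permutes_in_image[OF \<open>\<pi> permutes {..<n}\<close>, of i] by simp_all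
      then show "(\<Sum>\<rho> | \<rho> permutes {..<n}. \<Prod>r<n. w (if r = \<pi> i then i else r) (\<rho> r))
          = quasi_id A $$ (i, \<pi> i)"
        by (rule entry[symmetric])
    qed
    finally show ?thesis .
  qed
  then have "absorbed (sum ?term (?P - {id}))"
    by (intro absorbed_sum) (auto simp: finite_permutations)
  moreover have "?term id = 1"
    using quasi_id_diag[OF assms(3,4)] by simp
  moreover have "trop_det (quasi_id A) = ?term id + sum ?term (?P - {id})"
  proof -
    have "dim_row (quasi_id A) = n"
      using assms(3) by (simp add: quasi_id_def)
    then have "trop_det (quasi_id A) = sum ?term ?P"
      by (simp add: trop_det_def atLeast0LessThan)
    then show ?thesis
      using permutes_id by (subst (asm) sum.remove[of _ id]) (auto simp: finite_permutations)
  qed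
  ultimately show ?thesis
    by (simp add: absorbed_def)
qed

end
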